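(* Let $\mathcal{S}$ be a family of maps from $[0,\infty)$ to $\mathcal{X}_2$ satisfying (S1)–(S5) and (L1)–(L3). Then $\mathcal{S}$ is pointwise dissipative (hence it admits the global attractor).
   Context: Setting: $\Omega\subset\mathbb{R}^N$, $1\le N\le3$, is a bounded smooth domain, $H=L^2(\Omega)$ with norm $\|\cdot\|$, $V=H^1_0(\Omega)$, $B:V\to V'$ with $\langle Bu,v\rangle=\int_\Omega\nabla u\cdot\nabla v$. $\lambda\ge0$, $I\ni0$ is an open interval, $W\in C^{1,1}_{\rm loc}(I;\mathbb{R})$, $W'(0)=0$, $W''\ge-\lambda$ a.e. in $I$, $\lim_{r\to\partial I}W'(r)\,\mathrm{sign}\,r=+\infty$. $\mathcal{X}_2:=\{u\in H:Bu,W'(u)\in H\}$ is a complete metric space with $d_2^2(u,v)=\|u-v\|^2+\|Bu-Bv\|^2+\|(W'(u)+\lambda u)-(W'(v)+\lambda v)\|^2$ (strong topology). Weak convergence $u_n\to u$ in $\mathcal{X}_2$ means that $u_n\to u$, $Bu_n\to Bu$, $W'(u_n)+\lambda u_n\to W'(u)+\lambda u$ weakly in $H$. Properties: (S1) for all $u_0\in\mathcal{X}_2$ there is at least one $u\in\mathcal{S}$ with $u(0)=u_0$; (S2) for all $u\in\mathcal{S}$ and $T\ge0$, the map $t\mapsto u(T+t)$ belongs to $\mathcal{S}$; (S3) if $u,v\in\mathcal{S}$ and $u(T)=v(0)$ for some $T>0$, then the map equal to $u$ on $[0,T]$ and to $v(\cdot-T)$ on $(T,\infty)$ belongs to $\mathcal{S}$;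 (S4) if $u,v\in\mathcal{S}$ and $u(T)=v(T)$ for some $T>0$, then $u=v$ on $[T,\infty)$; (S5) all elements of $\mathcal{S}$ are weakly continuous from $[0,\infty)$ to $\mathcal{X}_2$; and for every sequence $\{u_n\}\subset\mathcal{S}$ with $u_n(0)\to u_0$ strongly in $\mathcal{X}_2$, there exist a subsequence and $u\in\mathcal{S}$ with $u(0)=u_0$ such that, along it, $u_n(t)\to u(t)$ weakly for all $t>0$. (L1) $\mathcal{S}$ possesses a Liapounov function: a continuous $\mathcal{V}:\mathcal{X}_2\to\mathbb{R}$ such that $\mathcal{V}(u(t))\le\mathcal{V}(u(s))$ for all $u\in\mathcal{S}$, $t\ge s\ge0$, and such that if $\psi:\mathbb{R}\to\mathcal{X}_2$ is a complete trajectory (i.e. $\psi(\cdot+\tau)|_{[0,\infty)}\in\mathcal{S}$ for all $\tau\in\mathbb{R}$) along which $\mathcal{V}$ is constant, then $\psi$ is constant. (L2) the set of stationary points of $\mathcal{S}$ (points $z$ such that the constant map $u\equiv z$ belongs to $\mathcal{S}$) is bounded in $\mathcal{X}_2$. (L3) for any sequence $\{u_n\}\subset\mathcal{S}$ with $\{u_n(0)\}$ bounded in $\mathcal{X}_2$ and any positive sequence $t_n\nearrow\infty$, the sequence $\{u_n(t_n)\}$ is precompact in $\mathcal{X}_2$ (strong topology). Pointwise dissipative: there exists a bounded $B_0\subset\mathcal{X}_2$ such that every $u\in\mathcal{S}$ satisfies $u(t)\in B_0$ for all sufficiently large $t$ (depending on $u$). $T(t)u:=\{v(t):v\in\mathcal{S},\,v(0)=u\}$,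 $T(t)D:=\bigcup_{u\in D}T(t)u$. Global attractor: a compact set $\mathcal{A}\subset\mathcal{X}_2$ with $T(t)\mathcal{A}=\mathcal{A}$ for all $t\ge0$ and $\lim_{t\to+\infty}\sup_{e\in T(t)D}\inf_{a\in\mathcal{A}}d_2(e,a)=0$ for every bounded $D\subset\mathcal{X}_2$. *)

theory Defs
  imports "HOL-Analysis.Analysis"
begin

section \<open>Smooth functions and smooth domains\<close>

text \<open>The derivatives are taken at interior points, so this is meant for open sets \<open>S\<close>.\<close>

fun cont_diff_on :: "nat \<Rightarrow> 'a::euclidean_space set \<Rightarrow> ('a \<Rightarrow> real) \<Rightarrow> bool" where
  "cont_diff_on 0 S f \<longleftrightarrow> continuous_on S f"
| "cont_diff_on (Suc k) S f \<longleftrightarrow>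
     (\<forall>x\<in>S. f differentiable (at x)) \<and>
     (\<forall>v. cont_diff_on k S (\<lambda>x. frechet_derivative f (at x) v))"

definition smooth_on :: "'a::euclidean_space set \<Rightarrow> ('a \<Rightarrow> real) \<Rightarrow> bool" where
  "smooth_on S f \<longleftrightarrow> (\<forall>k. cont_diff_on k S f)"

text \<open>Near each boundary point, in suitable Cartesian coordinates, the domain is the strict
  epigraph of a smooth function: \<open>e\<close> is the direction of the last coordinate, and \<open>\<gamma>\<close> is only
  evaluated on the hyperplane orthogonal to \<open>e\<close>, i.e. it is a function of the other coordinates.\<close>

definition smooth_boundary :: "'a::euclidean_space set \<Rightarrow> bool" where
  "smooth_boundary \<Omega> \<longleftrightarrow>
     (\<forall>x\<in>frontier \<Omega>. \<exists>r>0. \<exists>e \<gamma>. norm e = 1 \<and> smooth_on UNIV \<gamma> \<and>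
        \<Omega> \<inter> ball x r = {y \<in> ball x r. y \<bullet> e > \<gamma> (y - (y \<bullet> e) *\<^sub>R e)})"

definition bounded_smooth_domain :: "'a::euclidean_space set \<Rightarrow> bool" where
  "bounded_smooth_domain \<Omega> \<longleftrightarrow>
     open \<Omega> \<and> connected \<Omega> \<and> \<Omega> \<noteq> {} \<and> bounded \<Omega> \<and> smooth_boundary \<Omega>"


section \<open>The space $H = L^2(\Omega)$\<close>

text \<open>\<open>l2_functions\<close> are honest functions (their values off \<open>\<Omega>\<close> are irrelevant);
  elements of \<open>L2 \<Omega>\<close> are equivalence classes modulo equality a.e. in \<open>\<Omega>\<close>.\<close>

definition l2_functions :: "'a::euclidean_space set \<Rightarrow> ('a \<Rightarrow> 'b::euclidean_space) set" where
  "l2_functions \<Omega> = {f \<in> borel_measurable (lebesgue_on \<Omega>).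
                        integrable (lebesgue_on \<Omega>) (\<lambda>x. (norm (f x))\<^sup>2)}"

definition l2_inner :: "'a::euclidean_space set \<Rightarrow> ('a \<Rightarrow> 'b::euclidean_space) \<Rightarrow> ('a \<Rightarrow> 'b) \<Rightarrow> real" where
  "l2_inner \<Omega> f g = (LINT x|lebesgue_on \<Omega>. f x \<bullet> g x)"

definition l2_norm :: "'a::euclidean_space set \<Rightarrow> ('a \<Rightarrow> 'b::euclidean_space) \<Rightarrow> real" where
  "l2_norm \<Omega> f = sqrt (LINT x|lebesgue_on \<Omega>. (norm (f x))\<^sup>2)"

definition ae_rel :: "'a::euclidean_space set \<Rightarrow> (('a \<Rightarrow> real) \<times> ('a \<Rightarrow> real)) set" where
  "ae_rel \<Omega> = {(f, g). f \<in> l2_functions \<Omega> \<and> g \<in> l2_functions \<Omega> \<and>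
                        (AE x in lebesgue_on \<Omega>. f x = g x)}"

definition L2 :: "'a::euclidean_space set \<Rightarrow> ('a \<Rightarrow> real) set set" where
  "L2 \<Omega> = l2_functions \<Omega> // ae_rel \<Omega>"

text \<open>A representative of a class. Everything below is insensitive to its choice.\<close>

definition rep :: "('a \<Rightarrow> real) set \<Rightarrow> 'a \<Rightarrow> real" where
  "rep u = (SOME f. f \<in> u)"


section \<open>The space $V = H^1_0(\Omega)$ and the operator $B$\<close>

definition test_functions :: "'a::euclidean_space set \<Rightarrow> ('a \<Rightarrow> real) set" where
  "test_functions \<Omega> = {\<phi>. smooth_on UNIV \<phi> \<and>
                          (\<exists>K. compact K \<and> K \<subseteq> \<Omega> \<and> (\<forall>x. x \<notin> K \<longrightarrow> \<phi> x = 0))}"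

definition grad :: "('a::euclidean_space \<Rightarrow> real) \<Rightarrow> 'a \<Rightarrow> 'a" where
  "grad \<phi> x = (\<Sum>i\<in>Basis. frechet_derivative \<phi> (at x) i *\<^sub>R i)"

definition weak_gradient ::
    "'a::euclidean_space set \<Rightarrow> ('a \<Rightarrow> real) \<Rightarrow> ('a \<Rightarrow> 'a) \<Rightarrow> bool" where
  "weak_gradient \<Omega> f g \<longleftrightarrow> g \<in> l2_functions \<Omega> \<and>
     (\<forall>\<phi>\<in>test_functions \<Omega>. \<forall>i\<in>Basis.
        (LINT x|lebesgue_on \<Omega>. f x * (grad \<phi> x \<bullet> i)) = - (LINT x|lebesgue_on \<Omega>. (g x \<bullet> i) * \<phi> x))"

definition H1 :: "'a::euclidean_space set \<Rightarrow> ('a \<Rightarrow> real) set set" where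
  "H1 \<Omega> = {u \<in> L2 \<Omega>. \<exists>g. weak_gradient \<Omega> (rep u) g}"

text \<open>The weak gradient is unique a.e., so the choice does not matter.\<close>

definition wgrad :: "'a::euclidean_space set \<Rightarrow> ('a \<Rightarrow> real) set \<Rightarrow> 'a \<Rightarrow> 'a" where
  "wgrad \<Omega> u = (SOME g. weak_gradient \<Omega> (rep u) g)"

definition H10 :: "'a::euclidean_space set \<Rightarrow> ('a \<Rightarrow> real) set set" where
  "H10 \<Omega> = {u \<in> H1 \<Omega>. \<exists>\<phi>. (\<forall>n::nat. \<phi> n \<in> test_functions \<Omega>) \<and>
      (\<lambda>n. l2_norm \<Omega> (\<lambda>x. \<phi> n x - rep u x)) \<longlonglongrightarrow> 0 \<and>
      (\<lambda>n. l2_norm \<Omega> (\<lambda>x. grad (\<phi> n) x - wgrad \<Omega> u x)) \<longlonglongrightarrow> 0}"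

text \<open>\<open>B_op \<Omega> u v\<close> is the duality pairing $\langle Bu, v\rangle$.\<close>

definition B_op :: "'a::euclidean_space set \<Rightarrow> ('a \<Rightarrow> real) set \<Rightarrow> ('a \<Rightarrow> real) set \<Rightarrow> real" where
  "B_op \<Omega> u v = (LINT x|lebesgue_on \<Omega>. wgrad \<Omega> u x \<bullet> wgrad \<Omega> v x)"

text \<open>\<open>Bu \<in> H\<close> refers to the embedding of \<open>H\<close> into the dual of \<open>V\<close> given by the scalar product
  of \<open>H\<close>. As \<open>V\<close> is dense in \<open>H\<close>, the element of \<open>H\<close> that represents \<open>Bu\<close> is unique.\<close>

definition represents_B :: "'a::euclidean_space set \<Rightarrow> ('a \<Rightarrow> real) set \<Rightarrow> ('a \<Rightarrow> real) set \<Rightarrow> bool" where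
  "represents_B \<Omega> u f \<longleftrightarrow> f \<in> L2 \<Omega> \<and> (\<forall>v\<in>H10 \<Omega>. B_op \<Omega> u v = l2_inner \<Omega> (rep f) (rep v))"

definition BH :: "'a::euclidean_space set \<Rightarrow> ('a \<Rightarrow> real) set \<Rightarrow> ('a \<Rightarrow> real) set" where
  "BH \<Omega> u = (SOME f. represents_B \<Omega> u f)"


section \<open>The potential\<close>

text \<open>\<open>W\<close> is total, but only its restriction to the open interval \<open>einterval a b\<close> matters.
  The boundary of the interval is taken in the extended reals, so that for an unbounded interval
  the last two conditions are coercivity conditions at infinity. The existence of \<open>W''\<close> a.e. is a
  consequence of the local Lipschitz continuity of \<open>W'\<close>.\<close>

definition admissible_potential :: "ereal \<Rightarrow> ereal \<Rightarrow> (real \<Rightarrow> real) \<Rightarrow> real \<Rightarrow> bool" where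
  "admissible_potential a b W lam \<longleftrightarrow>
     (\<forall>r\<in>einterval a b. W differentiable (at r)) \<and>
     (\<forall>K. compact K \<and> K \<subseteq> einterval a b \<longrightarrow> (\<exists>L. L-lipschitz_on K (deriv W))) \<and>
     deriv W 0 = 0 \<and>
     (AE r in lborel. r \<in> einterval a b \<longrightarrow>
        (\<exists>D. (deriv W has_real_derivative D) (at r) \<and> D \<ge> - lam)) \<and>
     filterlim ((\<lambda>r. deriv W r * sgn r) \<circ> real_of_ereal) at_top (at_right a) \<and>
     filterlim ((\<lambda>r. deriv W r * sgn r) \<circ> real_of_ereal) at_top (at_left b)"


section \<open>The phase space\<close>

definition X2 :: "'a::euclidean_space set \<Rightarrow> real set \<Rightarrow> (real \<Rightarrow> real) \<Rightarrow> ('a \<Rightarrow> real) set set" where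
  "X2 \<Omega> I W = {u \<in> H10 \<Omega>. (\<exists>f. represents_B \<Omega> u f) \<and>
     (AE x in lebesgue_on \<Omega>. rep u x \<in> I) \<and> (\<lambda>x. deriv W (rep u x)) \<in> l2_functions \<Omega>}"

definition Wlam :: "(real \<Rightarrow> real) \<Rightarrow> real \<Rightarrow> ('a \<Rightarrow> real) set \<Rightarrow> 'a \<Rightarrow> real" where
  "Wlam W lam u x = deriv W (rep u x) + lam * rep u x"

definition d2 :: "'a::euclidean_space set \<Rightarrow> (real \<Rightarrow> real) \<Rightarrow> real \<Rightarrow>
    ('a \<Rightarrow> real) set \<Rightarrow> ('a \<Rightarrow> real) set \<Rightarrow> real" where
  "d2 \<Omega> W lam u v = sqrt ((l2_norm \<Omega> (\<lambda>x. rep u x - rep v x))\<^sup>2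
     + (l2_norm \<Omega> (\<lambda>x. rep (BH \<Omega> u) x - rep (BH \<Omega> v) x))\<^sup>2
     + (l2_norm \<Omega> (\<lambda>x. Wlam W lam u x - Wlam W lam v x))\<^sup>2)"

lemma rep_L2: "u \<in> L2 \<Omega> \<Longrightarrow> rep u \<in> l2_functions \<Omega>"
proof -
  assume "u \<in> L2 \<Omega>"
  then obtain f where f: "f \<in> l2_functions \<Omega>" "u = ae_rel \<Omega> `` {f}"
    unfolding L2_def by (auto elim: quotientE)
  then have "f \<in> u" by (auto simp: ae_rel_def)
  then have "rep u \<in> u" unfolding rep_def by (rule someI[where P="\<lambda>f. f \<in> _"])
  then show ?thesis using f by (auto simp: ae_rel_def)
qed

lemma L2_eqI:
  assumes "u \<in> L2 \<Omega>" "v \<in> L2 \<Omega>" "AE x in lebesgue_on \<Omega>. rep u x = rep v x"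
  shows "u = v"
proof -
  have *: "\<exists>f\<in>l2_functions \<Omega>. w = ae_rel \<Omega> `` {f} \<and> (f, rep w) \<in> ae_rel \<Omega>" if w: "w \<in> L2 \<Omega>" for w
  proof -
    obtain f where f: "f \<in> l2_functions \<Omega>" "w = ae_rel \<Omega> `` {f}"
      using w unfolding L2_def by (auto elim: quotientE)
    then have "f \<in> w" by (auto simp: ae_rel_def)
    then have "rep w \<in> w" unfolding rep_def by (rule someI[where P="\<lambda>f. f \<in> _"])
    then show ?thesis using f by auto
  qed
  obtain f g where f: "u = ae_rel \<Omega> `` {f}" "(f, rep u) \<in> ae_rel \<Omega>"
    and g: "v = ae_rel \<Omega> `` {g}" "(g, rep v) \<in> ae_rel \<Omega>"
    using *[OF assms(1)] *[OF assms(2)] by blast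
  have AEfg: "AE x in lebesgue_on \<Omega>. f x = g x"
    using f(2) g(2) assms(3) unfolding ae_rel_def by (auto elim: AE_mp)
  have "(f, h) \<in> ae_rel \<Omega> \<longleftrightarrow> (g, h) \<in> ae_rel \<Omega>" for h
  proof -
    have "(AE x in lebesgue_on \<Omega>. f x = h x) \<longleftrightarrow> (AE x in lebesgue_on \<Omega>. g x = h x)"
    proof
      assume "AE x in lebesgue_on \<Omega>. f x = h x"
      with AEfg show "AE x in lebesgue_on \<Omega>. g x = h x" by eventually_elim simp
    next
      assume "AE x in lebesgue_on \<Omega>. g x = h x"
      with AEfg show "AE x in lebesgue_on \<Omega>. f x = h x" by eventually_elim simp
    qed
    then show ?thesis using f(2) g(2) unfolding ae_rel_def by auto
  qed
  then show ?thesis using f g by blast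
qed

lemma l2_functions_mult:
  fixes f g :: "'a::euclidean_space \<Rightarrow> real"
  assumes "f \<in> l2_functions \<Omega>" "g \<in> l2_functions \<Omega>"
  shows "integrable (lebesgue_on \<Omega>) (\<lambda>x. f x * g x)"
proof (rule Bochner_Integration.integrable_bound)
  show "integrable (lebesgue_on \<Omega>) (\<lambda>x. (f x)\<^sup>2 + (g x)\<^sup>2)"
    using assms by (auto simp: l2_functions_def)
  show "(\<lambda>x. f x * g x) \<in> borel_measurable (lebesgue_on \<Omega>)"
    using assms by (auto simp: l2_functions_def)
  have "\<bar>p * q\<bar> \<le> \<bar>p\<^sup>2 + q\<^sup>2\<bar>" for p q :: real
  proof -
    have "2 * \<bar>p\<bar> * \<bar>q\<bar> \<le> \<bar>p\<bar>\<^sup>2 + \<bar>q\<bar>\<^sup>2" by (rule sum_squares_bound)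
    moreover have "0 \<le> \<bar>p\<bar> * \<bar>q\<bar>" by simp
    ultimately have "\<bar>p\<bar> * \<bar>q\<bar> \<le> p\<^sup>2 + q\<^sup>2" by (simp only: power2_abs)
    then show ?thesis by (simp add: abs_mult)
  qed
  then show "AE x in lebesgue_on \<Omega>. norm (f x * g x) \<le> norm ((f x)\<^sup>2 + (g x)\<^sup>2)" by simp
qed

lemma l2_functions_diff:
  fixes f g :: "'a::euclidean_space \<Rightarrow> real"
  assumes "f \<in> l2_functions \<Omega>" "g \<in> l2_functions \<Omega>"
  shows "(\<lambda>x. f x - g x) \<in> l2_functions \<Omega>"
  using assms l2_functions_mult[OF assms]
  by (auto simp: l2_functions_def power2_diff mult.assoc)

lemma l2_functions_lincomb:
  fixes f g :: "'a::euclidean_space \<Rightarrow> real"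
  assumes "f \<in> l2_functions \<Omega>" "g \<in> l2_functions \<Omega>"
  shows "(\<lambda>x. f x + c * g x) \<in> l2_functions \<Omega>"
proof -
  have "(\<lambda>x. (f x + c * g x)\<^sup>2) = (\<lambda>x. (f x)\<^sup>2 + c\<^sup>2 * (g x)\<^sup>2 + (2 * c) * (f x * g x))"
    by (auto simp: power2_eq_square algebra_simps)
  then show ?thesis
    using assms l2_functions_mult[OF assms] by (auto simp: l2_functions_def)
qed

lemma l2_norm_triangle:
  fixes f g :: "'a::euclidean_space \<Rightarrow> real"
  assumes f: "f \<in> l2_functions \<Omega>" and g: "g \<in> l2_functions \<Omega>"
  shows "l2_norm \<Omega> (\<lambda>x. f x + g x) \<le> l2_norm \<Omega> f + l2_norm \<Omega> g"
proof -
  let ?M = "lebesgue_on \<Omega>"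
  define A B C where "A = (LINT x|?M. (f x)\<^sup>2)" and "B = (LINT x|?M. (g x)\<^sup>2)"
    and "C = (LINT x|?M. f x * g x)"
  have int: "integrable ?M (\<lambda>x. (f x)\<^sup>2)" "integrable ?M (\<lambda>x. (g x)\<^sup>2)"
      "integrable ?M (\<lambda>x. f x * g x)"
    using assms l2_functions_mult[OF f g] by (auto simp: l2_functions_def)
  have expand: "(LINT x|?M. (s * f x + t * g x)\<^sup>2) = s\<^sup>2 * A + 2 * s * t * C + t\<^sup>2 * B" for s t
  proof -
    have "(LINT x|?M. (s * f x + t * g x)\<^sup>2)
        = (LINT x|?M. s\<^sup>2 * (f x)\<^sup>2 + (2 * s * t) * (f x * g x) + t\<^sup>2 * (g x)\<^sup>2)"
      by (rule Bochner_Integration.integral_cong) (auto simp: power2_eq_square algebra_simps)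
    also have "\<dots> = s\<^sup>2 * A + (2 * s * t) * C + t\<^sup>2 * B"
      using int by (simp add: A_def B_def C_def)
    finally show ?thesis .
  qed
  have nn: "0 \<le> s\<^sup>2 * A + 2 * s * t * C + t\<^sup>2 * B" for s t
    unfolding expand[symmetric] by simp
  have A: "A \<ge> 0" and B: "B \<ge> 0" unfolding A_def B_def by auto
  have "C \<le> sqrt A * sqrt B"
  proof (cases "A = 0 \<or> B = 0")
    case True
    have "C \<le> e" if "e > 0" for e
    proof -
      define k where "k = (A + B + 1) / (2 * e)"
      have k: "k > 0" using A B that by (simp add: k_def)
      have "C \<le> (A + B) / (2 * k)" 
        using True nn[of 1 "-k"] nn[of k "-1"] k A B
        by (auto simp: field_simps power2_eq_square) 
      also have "\<dots> = (A + B) * e / (A + B + 1)" using that A B by (simp add: k_def field_simps)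
      also have "\<dots> \<le> e" using that A B by (simp add: field_simps)
      finally show ?thesis .
    qed
    then have "C \<le> 0" by (meson dense not_le)
    then show ?thesis using True by auto
  next
    case False
    then have pos: "sqrt A > 0" "sqrt B > 0" using A B by auto
    have "0 \<le> (sqrt B)\<^sup>2 * A + 2 * sqrt B * (- sqrt A) * C + (- sqrt A)\<^sup>2 * B" by (rule nn)
    also have "\<dots> = 2 * (sqrt A * sqrt B) * (sqrt A * sqrt B - C)"
      using A B by (simp add: algebra_simps power2_eq_square)
    finally have "0 \<le> 2 * (sqrt A * sqrt B) * (sqrt A * sqrt B - C)" .
    moreover have "0 < 2 * (sqrt A * sqrt B)" using pos by simp
    ultimately show ?thesis by (simp add: zero_le_mult_iff)
  qed
  then have "(LINT x|?M. (f x + g x)\<^sup>2) \<le> (sqrt A + sqrt B)\<^sup>2"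
    using expand[of 1 1] A B by (simp add: power2_sum)
  then have "sqrt (LINT x|?M. (f x + g x)\<^sup>2) \<le> sqrt A + sqrt B"
    using A B by (meson add_nonneg_nonneg real_le_lsqrt real_sqrt_ge_zero)
  then show ?thesis by (simp add: l2_norm_def A_def B_def)
qed

lemma l2_norm_diff_triangle:
  fixes f g h :: "'a::euclidean_space \<Rightarrow> real"
  assumes "f \<in> l2_functions \<Omega>" "g \<in> l2_functions \<Omega>" "h \<in> l2_functions \<Omega>"
  shows "l2_norm \<Omega> (\<lambda>x. f x - h x) \<le> l2_norm \<Omega> (\<lambda>x. f x - g x) + l2_norm \<Omega> (\<lambda>x. g x - h x)"
  using l2_norm_triangle[OF l2_functions_diff[OF assms(1,2)] l2_functions_diff[OF assms(2,3)]]
  by simp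

lemma X2_components:
  assumes "u \<in> X2 \<Omega> I W"
  shows "u \<in> L2 \<Omega>" "rep u \<in> l2_functions \<Omega>" "represents_B \<Omega> u (BH \<Omega> u)"
    "rep (BH \<Omega> u) \<in> l2_functions \<Omega>" "Wlam W lam u \<in> l2_functions \<Omega>"
proof -
  show u: "u \<in> L2 \<Omega>" using assms by (auto simp: X2_def H10_def H1_def)
  then show r: "rep u \<in> l2_functions \<Omega>" by (rule rep_L2)
  show B: "represents_B \<Omega> u (BH \<Omega> u)"
    using assms unfolding BH_def X2_def by (auto intro: someI)
  then show "rep (BH \<Omega> u) \<in> l2_functions \<Omega>" by (auto simp: represents_B_def intro: rep_L2)
  have "(\<lambda>x. deriv W (rep u x)) \<in> l2_functions \<Omega>" using assms by (auto simp: X2_def)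
  from l2_functions_lincomb[OF this r] show "Wlam W lam u \<in> l2_functions \<Omega>"
    by (simp add: Wlam_def[abs_def])
qed

proposition X2_Metric_space: "Metric_space (X2 \<Omega> I W) (d2 \<Omega> W lam)"
proof
  show "0 \<le> d2 \<Omega> W lam u v" for u v by (simp add: d2_def)
  have comm: "l2_norm \<Omega> (\<lambda>x. f x - g x) = l2_norm \<Omega> (\<lambda>x. g x - f x)" for f g :: "'a \<Rightarrow> real"
    by (simp add: l2_norm_def power2_commute)
  show "d2 \<Omega> W lam u v = d2 \<Omega> W lam v u" for u v
    unfolding d2_def by (metis comm)
  show "(d2 \<Omega> W lam u v = 0) = (u = v)" if u: "u \<in> X2 \<Omega> I W" and v: "v \<in> X2 \<Omega> I W" for u v
  proof
    assume "d2 \<Omega> W lam u v = 0"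
    then have "(l2_norm \<Omega> (\<lambda>x. rep u x - rep v x))\<^sup>2 = 0"
      unfolding d2_def real_sqrt_eq_zero_cancel_iff
      by (smt (verit) zero_le_power2)
    then have "(LINT x|lebesgue_on \<Omega>. (rep u x - rep v x)\<^sup>2) = 0"
      by (simp add: l2_norm_def)
    moreover have "integrable (lebesgue_on \<Omega>) (\<lambda>x. (rep u x - rep v x)\<^sup>2)"
      using l2_functions_diff[OF X2_components(2)[OF u] X2_components(2)[OF v]]
      by (simp add: l2_functions_def)
    ultimately have "AE x in lebesgue_on \<Omega>. (rep u x - rep v x)\<^sup>2 = 0"
      by (subst (asm) integral_nonneg_eq_0_iff_AE) auto
    then show "u = v"
      by (intro L2_eqI[OF X2_components(1)[OF u] X2_components(1)[OF v]]) auto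
  qed (simp add: d2_def l2_norm_def)
  show "d2 \<Omega> W lam u w \<le> d2 \<Omega> W lam u v + d2 \<Omega> W lam v w"
    if "u \<in> X2 \<Omega> I W" "v \<in> X2 \<Omega> I W" "w \<in> X2 \<Omega> I W" for u v w
  proof -
    define n where "n p q = (l2_norm \<Omega> (\<lambda>x. rep p x - rep q x),
        l2_norm \<Omega> (\<lambda>x. rep (BH \<Omega> p) x - rep (BH \<Omega> q) x),
        l2_norm \<Omega> (\<lambda>x. Wlam W lam p x - Wlam W lam q x))" for p q
    have d2_n: "d2 \<Omega> W lam p q = norm (n p q)" for p q
      by (simp add: d2_def n_def norm_Pair algebra_simps)
    have mono: "norm (p, q, r) \<le> norm (p', q', r')"
      if "0 \<le> p" "p \<le> p'" "0 \<le> q" "q \<le> q'" "0 \<le> r" "r \<le> r'" for p q r p' q' r' :: real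
      using that by (auto simp: norm_Pair intro!: add_mono power_mono)
    have "norm (n u w) \<le> norm (n u v + n v w)"
      unfolding n_def add_Pair
      by (intro mono l2_norm_diff_triangle)
         (auto simp: l2_norm_def intro: that X2_components(2,4,5))
    also have "\<dots> \<le> norm (n u v) + norm (n v w)" by (rule norm_triangle_ineq)
    finally show ?thesis by (simp add: d2_n)
  qed
qed

definition weakly_tends :: "'a::euclidean_space set \<Rightarrow> (real \<Rightarrow> real) \<Rightarrow> real \<Rightarrow>
    ('i \<Rightarrow> ('a \<Rightarrow> real) set) \<Rightarrow> ('a \<Rightarrow> real) set \<Rightarrow> 'i filter \<Rightarrow> bool" where
  "weakly_tends \<Omega> W lam u l F \<longleftrightarrow> (\<forall>h\<in>l2_functions \<Omega>.
     ((\<lambda>i. l2_inner \<Omega> (rep (u i)) h) \<longlongrightarrow> l2_inner \<Omega> (rep l) h) F \<and>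
     ((\<lambda>i. l2_inner \<Omega> (rep (BH \<Omega> (u i))) h) \<longlongrightarrow> l2_inner \<Omega> (rep (BH \<Omega> l)) h) F \<and>
     ((\<lambda>i. l2_inner \<Omega> (Wlam W lam (u i)) h) \<longlongrightarrow> l2_inner \<Omega> (Wlam W lam l) h) F)"


section \<open>Families of trajectories\<close>

text \<open>Maps from $[0,\infty)$ to \<open>X\<close> are elements of \<open>{0..} \<rightarrow>\<^sub>E X\<close>, so that equality of functions is
  equality on $[0,\infty)$.\<close>

definition cond_S1 :: "'x set \<Rightarrow> (real \<Rightarrow> 'x) set \<Rightarrow> bool" where
  "cond_S1 X S \<longleftrightarrow> (\<forall>u0\<in>X. \<exists>u\<in>S. u 0 = u0)"

definition cond_S2 :: "(real \<Rightarrow> 'x) set \<Rightarrow> bool" where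
  "cond_S2 S \<longleftrightarrow> (\<forall>u\<in>S. \<forall>T\<ge>0. (\<lambda>t\<in>{0..}. u (T + t)) \<in> S)"

definition cond_S3 :: "(real \<Rightarrow> 'x) set \<Rightarrow> bool" where
  "cond_S3 S \<longleftrightarrow> (\<forall>u\<in>S. \<forall>v\<in>S. \<forall>T>0. u T = v 0 \<longrightarrow>
     (\<lambda>t\<in>{0..}. if t \<le> T then u t else v (t - T)) \<in> S)"

definition cond_S4 :: "(real \<Rightarrow> 'x) set \<Rightarrow> bool" where
  "cond_S4 S \<longleftrightarrow> (\<forall>u\<in>S. \<forall>v\<in>S. \<forall>T>0. u T = v T \<longrightarrow> (\<forall>t\<ge>T. u t = v t))"

definition cond_S5 :: "'a::euclidean_space set \<Rightarrow> real set \<Rightarrow> (real \<Rightarrow> real) \<Rightarrow> real \<Rightarrow>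
    (real \<Rightarrow> ('a \<Rightarrow> real) set) set \<Rightarrow> bool" where
  "cond_S5 \<Omega> I W lam S \<longleftrightarrow>
     (\<forall>u\<in>S. \<forall>t\<ge>0. weakly_tends \<Omega> W lam u (u t) (at t within {0..})) \<and>
     (\<forall>us u0. (\<forall>n. us n \<in> S) \<and>
         limitin (Metric_space.mtopology (X2 \<Omega> I W) (d2 \<Omega> W lam)) (\<lambda>n. us n 0) u0 sequentially \<longrightarrow>
       (\<exists>r u. strict_mono r \<and> u \<in> S \<and> u 0 = u0 \<and>
          (\<forall>t>0. weakly_tends \<Omega> W lam (\<lambda>n. us (r n) t) (u t) sequentially)))"

definition complete_trajectory :: "(real \<Rightarrow> 'x) set \<Rightarrow> (real \<Rightarrow> 'x) \<Rightarrow> bool" where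
  "complete_trajectory S \<psi> \<longleftrightarrow> (\<forall>\<tau>. (\<lambda>t\<in>{0..}. \<psi> (t + \<tau>)) \<in> S)"

definition cond_L1 :: "'x set \<Rightarrow> ('x \<Rightarrow> 'x \<Rightarrow> real) \<Rightarrow> (real \<Rightarrow> 'x) set \<Rightarrow> bool" where
  "cond_L1 X d S \<longleftrightarrow> (\<exists>V. continuous_map (Metric_space.mtopology X d) euclideanreal V \<and>
     (\<forall>u\<in>S. \<forall>s\<ge>0. \<forall>t\<ge>s. V (u t) \<le> V (u s)) \<and>
     (\<forall>\<psi>. complete_trajectory S \<psi> \<and> (\<exists>c. \<forall>t. V (\<psi> t) = c) \<longrightarrow> (\<exists>z. \<forall>t. \<psi> t = z)))"

definition stationary_points :: "'x set \<Rightarrow> (real \<Rightarrow> 'x) set \<Rightarrow> 'x set" where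
  "stationary_points X S = {z \<in> X. (\<lambda>t\<in>{0..}. z) \<in> S}"

definition cond_L2 :: "'x set \<Rightarrow> ('x \<Rightarrow> 'x \<Rightarrow> real) \<Rightarrow> (real \<Rightarrow> 'x) set \<Rightarrow> bool" where
  "cond_L2 X d S \<longleftrightarrow> Metric_space.mbounded X d (stationary_points X S)"

definition cond_L3 :: "'x set \<Rightarrow> ('x \<Rightarrow> 'x \<Rightarrow> real) \<Rightarrow> (real \<Rightarrow> 'x) set \<Rightarrow> bool" where
  "cond_L3 X d S \<longleftrightarrow> (\<forall>us t. (\<forall>n::nat. us n \<in> S) \<and> Metric_space.mbounded X d (range (\<lambda>n. us n 0)) \<and>
       (\<forall>n. t n > 0) \<and> incseq t \<and> filterlim t at_top sequentially \<longrightarrow>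
     compactin (Metric_space.mtopology X d)
       (Metric_space.mtopology X d closure_of range (\<lambda>n. us n (t n))))"

definition pointwise_dissipative :: "'x set \<Rightarrow> ('x \<Rightarrow> 'x \<Rightarrow> real) \<Rightarrow> (real \<Rightarrow> 'x) set \<Rightarrow> bool" where
  "pointwise_dissipative X d S \<longleftrightarrow>
     (\<exists>B0. Metric_space.mbounded X d B0 \<and> (\<forall>u\<in>S. \<forall>\<^sub>F t in at_top. u t \<in> B0))"

definition reach :: "(real \<Rightarrow> 'x) set \<Rightarrow> real \<Rightarrow> 'x set \<Rightarrow> 'x set" where
  "reach S t D = (\<Union>u\<in>D. {v t | v. v \<in> S \<and> v 0 = u})"

text \<open>Since \<open>reach S t D\<close> may a priori be unbounded, the semidistance is taken in \<^typ>\<open>ennreal\<close>.\<close>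

definition global_attractor :: "'x set \<Rightarrow> ('x \<Rightarrow> 'x \<Rightarrow> real) \<Rightarrow> (real \<Rightarrow> 'x) set \<Rightarrow> 'x set \<Rightarrow> bool" where
  "global_attractor X d S A \<longleftrightarrow>
     compactin (Metric_space.mtopology X d) A \<and>
     (\<forall>t\<ge>0. reach S t A = A) \<and>
     (\<forall>D. Metric_space.mbounded X d D \<longrightarrow>
        ((\<lambda>t. SUP e\<in>reach S t D. INF a\<in>A. ennreal (d e a)) \<longlongrightarrow> 0) at_top)"

end

theory Submission
  imports Defs
begin

text \<open>Through every point of the $\omega$-limit set of a bounded set \<open>D\<close> runs a complete trajectory
  in that (compact) limit set; its $\alpha$-limit points are stationary by the Liapounov function.
  Hence the point is reached after arbitrarily long times from the unit neighbourhood \<open>D\<^sub>1\<close> of the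
  stationary points, which is bounded by (L2), so that it already belongs to the $\omega$-limit set
  of \<open>D\<^sub>1\<close>. That single compact set therefore attracts every bounded \<open>D\<close>, and one of its
  neighbourhoods absorbs all trajectories.\<close>

section \<open>Families of trajectories in a metric space\<close>

lemma filterlim_subseq_compose:
  assumes "filterlim t F sequentially" "strict_mono (r :: nat \<Rightarrow> nat)"
  shows "filterlim (\<lambda>n. t (r n)) F sequentially"
  using assms filterlim_compose filterlim_subseq by blast

text \<open>(L3) speaks of positive increasing times, whereas limit sets only provide diverging
  ones. A monotone subsequence exists, and divergence excludes that it decreases.\<close>

lemma diverging_real_seq_incseq_subseq:
  fixes t :: "nat \<Rightarrow> real"
  assumes "filterlim t at_top sequentially"
  obtains r :: "nat \<Rightarrow> nat" where "strict_mono r" "incseq (\<lambda>n. t (r n))" "\<And>n. t (r n) > 0"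
proof -
  obtain f :: "nat \<Rightarrow> nat" where f: "strict_mono f" "monoseq (\<lambda>n. t (f n))"
    using seq_monosub by blast
  have lim: "filterlim (\<lambda>n. t (f n)) at_top sequentially"
    by (rule filterlim_subseq_compose[OF assms f(1)])
  have "\<not> decseq (\<lambda>n. t (f n))"
  proof
    assume "decseq (\<lambda>n. t (f n))"
    then have "t (f n) \<le> t (f 0)" for n by (simp add: decseq_def)
    moreover obtain n where "t (f n) > t (f 0)"
      using filterlim_at_top_dense[THEN iffD1, OF lim, rule_format, of "t (f 0)"]
      by (auto simp: eventually_sequentially)
    ultimately show False by (simp add: not_less[symmetric])
  qed
  then have inc: "incseq (\<lambda>n. t (f n))"
    using f(2) by (simp add: monoseq_iff)
  obtain N where N: "\<And>n. n \<ge> N \<Longrightarrow> t (f n) > 0"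
    using filterlim_at_top_dense[THEN iffD1, OF lim, rule_format, of 0]
    by (auto simp: eventually_sequentially)
  show ?thesis
  proof (rule that[of "\<lambda>n. f (n + N)"])
    show "strict_mono (\<lambda>n. f (n + N))" using f(1) by (simp add: strict_mono_def)
    show "incseq (\<lambda>n. t (f (n + N)))" using inc by (simp add: incseq_def)
    show "t (f (n + N)) > 0" for n using N by simp
  qed
qed

lemma choice2: "(\<And>x. \<exists>y z. P x y z) \<Longrightarrow> \<exists>f g. \<forall>x. P x (f x) (g x)"
  by metis

text \<open>The relation \<open>weak\<close> stands for weak sequential convergence in the phase
  space. It enters only through the closedness in (S5) and through \<open>weak_eq_strong\<close>: a
  weak limit equals any strong limit along a subsequence.\<close>

locale gradient_family = Metric_space M d for M :: "'x set" and d +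
  fixes S :: "(real \<Rightarrow> 'x) set" and weak :: "(nat \<Rightarrow> 'x) \<Rightarrow> 'x \<Rightarrow> bool"
  assumes trajectories: "S \<subseteq> {0..} \<rightarrow>\<^sub>E M"
    and S2: "cond_S2 S" and S3: "cond_S3 S" and S4: "cond_S4 S"
    and weak_closed: "\<lbrakk>\<And>n. us n \<in> S; limitin mtopology (\<lambda>n. us n 0) u0 sequentially\<rbrakk> \<Longrightarrow>
      \<exists>r u. strict_mono r \<and> u \<in> S \<and> u 0 = u0 \<and> (\<forall>t>0. weak (\<lambda>n. us (r n) t) (u t))"
    and weak_eq_strong: "\<lbrakk>weak x y; y \<in> M; strict_mono r; limitin mtopology (\<lambda>n. x (r n)) z sequentially\<rbrakk>
      \<Longrightarrow> y = z"
    and L1: "cond_L1 M d S" and L2: "cond_L2 M d S" and L3: "cond_L3 M d S"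
begin

abbreviation tends :: "(nat \<Rightarrow> 'x) \<Rightarrow> 'x \<Rightarrow> bool" where
  "tends x l \<equiv> limitin mtopology x l sequentially"

lemma tends_subseq: "tends x l \<Longrightarrow> strict_mono r \<Longrightarrow> tends (\<lambda>n. x (r n)) l"
  using limitin_subsequence[of r mtopology x l] by (simp add: o_def)

lemma tends_in: "tends x l \<Longrightarrow> l \<in> M"
  by (simp add: limitin_metric)

lemma traj_in: "u \<in> S \<Longrightarrow> t \<ge> 0 \<Longrightarrow> u t \<in> M"
  using trajectories by fastforce

lemma shift_in: "u \<in> S \<Longrightarrow> T \<ge> 0 \<Longrightarrow> (\<lambda>t\<in>{0..}. u (T + t)) \<in> S"
  using S2 by (simp add: cond_S2_def)

lemma concat_in:
  "\<lbrakk>u \<in> S; v \<in> S; T > 0; u T = v 0\<rbrakk> \<Longrightarrow> (\<lambda>t\<in>{0..}. if t \<le> T then u t else v (t - T)) \<in> S"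
  using S3 by (simp add: cond_S3_def)

lemma compactin_tends_subseq:
  assumes "compactin mtopology K" "\<And>n. x n \<in> K"
  obtains r l where "strict_mono (r :: nat \<Rightarrow> nat)" "l \<in> K" "tends (\<lambda>n. x (r n)) l"
proof -
  have "range x \<subseteq> K" using assms(2) by auto
  then obtain l r where "l \<in> K" "strict_mono (r :: nat \<Rightarrow> nat)" "tends (x \<circ> r) l"
    using assms(1) unfolding compactin_sequentially by blast
  then show ?thesis using that by (simp add: o_def)
qed

text \<open>(L3) for arbitrary diverging times: it applies along a positive increasing subsequence
  of them, and compactness of the closure gives a further convergent subsequence.\<close>

lemma asymptotically_compact:
  assumes us: "\<And>n. us n \<in> S" and bdd: "mbounded (range (\<lambda>n. us n 0))"
    and t: "filterlim t at_top sequentially"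
  obtains r z where "strict_mono (r :: nat \<Rightarrow> nat)" "tends (\<lambda>n. us (r n) (t (r n))) z"
proof -
  obtain q :: "nat \<Rightarrow> nat" where q: "strict_mono q" "incseq (\<lambda>n. t (q n))" "\<And>n. t (q n) > 0"
    using diverging_real_seq_incseq_subseq[OF t] by blast
  have "mbounded (range (\<lambda>n. us (q n) 0))"
    by (rule mbounded_subset[OF bdd]) auto
  then have K: "compactin mtopology (mtopology closure_of range (\<lambda>n. us (q n) (t (q n))))"
    using L3[unfolded cond_L3_def, rule_format, of "\<lambda>n. us (q n)" "\<lambda>n. t (q n)"]
      us q filterlim_subseq_compose[OF t q(1)] by simp
  have "range (\<lambda>n. us (q n) (t (q n))) \<subseteq> topspace mtopology"
    using traj_in[OF us less_imp_le[OF q(3)]] by auto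
  then have "us (q n) (t (q n)) \<in> mtopology closure_of range (\<lambda>n. us (q n) (t (q n)))" for n
    using closure_of_subset[of _ mtopology] by (meson rangeI subsetD)
  then obtain r l
    where r: "strict_mono (r :: nat \<Rightarrow> nat)" "tends (\<lambda>n. us (q (r n)) (t (q (r n)))) l"
    by (rule compactin_tends_subseq[OF K])
  show ?thesis
    using that[of "\<lambda>n. q (r n)" l] r q(1) by (simp add: strict_mono_def)
qed

text \<open>Only weak limits are supplied by the closedness of \<open>S\<close>; asymptotic compactness turns
  them into strong ones.\<close>

lemma backward_step:
  assumes us: "\<And>n. us n \<in> S" and bdd: "mbounded (range (\<lambda>n. us n 0))"
    and t: "filterlim t at_top sequentially"
    and z: "tends (\<lambda>n. us n (t n)) z"
  obtains v where "v \<in> S" "v 1 = z"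
    "\<And>s. s \<ge> 0 \<Longrightarrow> \<exists>r. strict_mono r \<and> tends (\<lambda>n. us (r n) (t (r n) + (s - 1))) (v s)"
proof -
  have shifted: "filterlim (\<lambda>n. t (r n) + c) at_top sequentially"
    if "strict_mono r" for r :: "nat \<Rightarrow> nat" and c
    using filterlim_tendsto_add_at_top[OF tendsto_const[of c] filterlim_subseq_compose[OF t that]]
    by (simp add: add.commute)
  have bdd': "mbounded (range (\<lambda>n. us (r n) 0))" for r :: "nat \<Rightarrow> nat"
    by (rule mbounded_subset[OF bdd]) auto
  \<comment> \<open>Going back by one time unit requires \<open>t n > 1\<close>, which holds along a
    subsequence.\<close>
  have "filterlim (\<lambda>n. t n + (-1)) at_top sequentially"
    by (rule shifted) (simp add: strict_mono_def)
  then obtain p :: "nat \<Rightarrow> nat" where p: "strict_mono p" "\<And>n. t (p n) + (-1) > 0"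
    by (rule diverging_real_seq_incseq_subseq) blast
  \<comment> \<open>\<open>weak_closed\<close> needs strongly convergent initial points; asymptotic
    compactness at the times \<open>t - 1\<close> supplies them.\<close>
  obtain p' y where p': "strict_mono (p' :: nat \<Rightarrow> nat)"
    and y: "tends (\<lambda>n. us (p (p' n)) (t (p (p' n)) + (-1))) y"
    by (rule asymptotically_compact[of "\<lambda>n. us (p n)", OF us bdd' shifted[OF p(1)]])
  define q where "q n = p (p' n)" for n
  have q: "strict_mono q" using p(1) p' by (simp add: q_def strict_mono_def)
  have tq: "t (q n) > 1" for n using p(2)[of "p' n"] by (simp add: q_def)
  define ws where "ws n = (\<lambda>\<tau>\<in>{0..}. us (q n) ((t (q n) - 1) + \<tau>))" for n
  have ws: "ws n \<in> S" for n
    unfolding ws_def using tq[of n] us by (intro shift_in) auto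
  have "tends (\<lambda>n. ws n 0) y"
    using y by (simp add: ws_def q_def)
  from weak_closed[of ws, OF ws this] obtain r v where r: "strict_mono r" and v: "v \<in> S" "v 0 = y"
    and wk: "\<And>s. s > 0 \<Longrightarrow> weak (\<lambda>n. ws (r n) s) (v s)" by blast
  have lim: "\<exists>r. strict_mono r \<and> tends (\<lambda>n. us (r n) (t (r n) + (s - 1))) (v s)" if "s \<ge> 0" for s
  proof (cases "s = 0")
    case True
    then show ?thesis using q y v(2) by (intro exI[of _ q]) (simp add: q_def)
  next
    case False
    with that have s: "s > 0" by simp
    \<comment> \<open>The further subsequence depends on \<open>s\<close>, but its strong limit is
      always the already fixed weak limit \<open>v s\<close>.\<close>
    have qr: "strict_mono (\<lambda>n. q (r n))" using q r by (simp add: strict_mono_def)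
    obtain r' l where r': "strict_mono (r' :: nat \<Rightarrow> nat)"
      and l: "tends (\<lambda>n. us (q (r (r' n))) (t (q (r (r' n))) + (s - 1))) l"
      by (rule asymptotically_compact[of "\<lambda>n. us (q (r n))", OF us bdd' shifted[OF qr]])
    have "tends (\<lambda>n. ws (r (r' n)) s) l"
      using l s by (simp add: ws_def algebra_simps)
    with wk[OF s] r' have "v s = l"
      using weak_eq_strong[of "\<lambda>n. ws (r n) s" "v s" r' l] traj_in[OF v(1), of s] s by simp
    with l qr r' show ?thesis
      by (intro exI[of _ "\<lambda>n. q (r (r' n))"]) (auto simp: strict_mono_def)
  qed
  obtain r1 where r1: "strict_mono r1" "tends (\<lambda>n. us (r1 n) (t (r1 n))) (v 1)"
    using lim[of 1] by auto
  have "v 1 = z"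
    by (rule limitin_metric_unique[OF r1(2) tends_subseq[OF z r1(1)]]) simp
  from that[OF v(1) this lim] show ?thesis .
qed

section \<open>Complete trajectories\<close>

text \<open>Since trajectories branch at time \<open>0\<close> only (\<open>S4\<close>), the pieces obtained by stepping
  backwards one time unit at a time are restrictions of one another.\<close>

lemma complete_trajectory_through:
  assumes step: "\<And>z. z \<in> L \<Longrightarrow> \<exists>v\<in>S. v 1 = z \<and> (\<forall>s\<ge>0. v s \<in> L)" and z: "z \<in> L"
  obtains \<psi> where "complete_trajectory S \<psi>" "\<psi> 0 = z" "\<And>t. \<psi> t \<in> L"
proof -
  \<comment> \<open>The last conjunct anchors the chain at \<open>z\<close>; each later piece
    arrives at time 1 where its predecessor starts.\<close>
  define P where "P n v \<longleftrightarrow> v \<in> S \<and> (\<forall>s\<ge>0. v s \<in> L) \<and> (n = (0::nat) \<longrightarrow> v 1 = z)" for n v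
  have "\<exists>v. \<forall>n. P n (v n) \<and> v (Suc n) 1 = v n 0"
  proof (rule dependent_nat_choice)
    show "\<exists>v. P 0 v" using step[OF z] by (auto simp: P_def)
    show "\<exists>w. P (Suc n) w \<and> w 1 = v 0" if "P n v" for v n
      using that step[of "v 0"] by (auto simp: P_def)
  qed
  then obtain v where P: "\<And>n. P n (v n)" and link: "\<And>n. v (Suc n) 1 = v n 0" by blast
  have vS: "v n \<in> S" and vL: "\<And>s. s \<ge> 0 \<Longrightarrow> v n s \<in> L" for n
    using P[of n] by (auto simp: P_def)
  have one: "v (Suc n) (1 + s) = v n s" if "s \<ge> 0" for n s
  proof -
    \<comment> \<open>(S4) cannot be applied to \<open>v n\<close> itself at its starting time 0.
      The concatenation moves that time to 1, where it meets \<open>v (Suc n)\<close>.\<close>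
    let ?p = "\<lambda>t\<in>{0..}. if t \<le> 1 then v (Suc n) t else v n (t - 1)"
    have p: "?p \<in> S" by (rule concat_in[OF vS vS]) (simp_all add: link)
    have "v (Suc n) (1 + s) = ?p (1 + s)"
      by (rule S4[unfolded cond_S4_def, rule_format, OF vS p, of 1]) (use that in auto)
    also have "\<dots> = v n s" using that link[of n] by auto
    finally show ?thesis .
  qed
  have many: "v (n + k) (real k + s) = v n s" if "s \<ge> 0" for n k s
  proof (induction k)
    case (Suc k)
    have "v (Suc (n + k)) (1 + (real k + s)) = v (n + k) (real k + s)"
      using that by (intro one) simp
    with Suc show ?case by (simp add: algebra_simps)
  qed simp
  define idx where "idx t = nat \<lceil>\<bar>t :: real\<bar>\<rceil>" for t
  have idx: "real (idx t) \<ge> \<bar>t\<bar>" for t by (simp add: idx_def)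
  \<comment> \<open>\<open>v 0\<close> is at \<open>z\<close> at its time 1, so \<open>v k\<close>
    starts at time \<open>- k - 1\<close> of \<open>\<psi>\<close>. Any \<open>k\<close> with
    \<open>t + k + 1 \<ge> 0\<close> gives the same value, as shown next.\<close>
  define \<psi> where "\<psi> t = v (idx t) (t + idx t + 1)" for t
  have \<psi>: "\<psi> t = v k (t + real k + 1)" if "t + real k + 1 \<ge> 0" for t k
  proof (cases "k \<le> idx t")
    case True
    then show ?thesis
      using many[OF that, of k "idx t - k"] by (simp add: \<psi>_def algebra_simps of_nat_diff)
  next
    case False
    have "t + real (idx t) + 1 \<ge> 0" using idx[of t] by linarith
    from many[OF this, of "idx t" "k - idx t"] False show ?thesis
      by (simp add: \<psi>_def algebra_simps of_nat_diff)
  qed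
  show ?thesis
  proof (rule that[of \<psi>])
    show "\<psi> 0 = z" using \<psi>[of 0 0] P[of 0] by (simp add: P_def)
    show "\<psi> t \<in> L" for t
      unfolding \<psi>_def using idx[of t] by (intro vL) linarith
    show "complete_trajectory S \<psi>"
      unfolding complete_trajectory_def
    proof
      fix \<tau>
      define k where "k = idx \<tau>"
      have k: "\<tau> + real k + 1 \<ge> 0" using idx[of \<tau>] unfolding k_def by linarith
      have "(\<lambda>t\<in>{0..}. \<psi> (t + \<tau>)) = (\<lambda>t\<in>{0..}. v k ((\<tau> + real k + 1) + t))"
        using k by (intro restrict_ext) (simp add: \<psi>[of _ k] algebra_simps)
      then show "(\<lambda>t\<in>{0..}. \<psi> (t + \<tau>)) \<in> S"
        using shift_in[OF vS k, of k] by simp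
    qed
  qed
qed

definition Z :: "'x set" where
  "Z = stationary_points M S"

text \<open>The $\alpha$-limit set \<open>L\<close> of \<open>\<psi>\<close> is backward invariant, and the Liapounov function is
  constant on it.\<close>

lemma alpha_limit_stationary:
  assumes \<psi>: "complete_trajectory S \<psi>" and K: "compactin mtopology K" and \<psi>K: "\<And>t. \<psi> t \<in> K"
  obtains y s where "y \<in> Z" "filterlim s at_top sequentially" "tends (\<lambda>n. \<psi> (- s n)) y"
proof -
  have shift\<psi>: "(\<lambda>t\<in>{0..}. \<psi> (t + \<tau>)) \<in> S" for \<tau>
    using \<psi> by (simp add: complete_trajectory_def)
  define L where "L = {y. \<exists>s. filterlim s at_top sequentially \<and> tends (\<lambda>n. \<psi> (- s n)) y}"
  obtain V where V: "continuous_map mtopology euclideanreal V"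
    and V_mono: "\<forall>u\<in>S. \<forall>s\<ge>0. \<forall>t\<ge>s. V (u t) \<le> V (u s)"
    and V_strict: "\<forall>\<phi>. complete_trajectory S \<phi> \<and> (\<exists>c. \<forall>t. V (\<phi> t) = c) \<longrightarrow> (\<exists>z. \<forall>t. \<phi> t = z)"
    using L1 unfolding cond_L1_def by blast
  have V\<psi>: "V (\<psi> t) \<le> V (\<psi> s)" if "s \<le> t" for s t
    using V_mono[rule_format, OF shift\<psi>[of s], of 0 "t - s"] that by simp
  have V_lim: "(\<lambda>n. V (x n)) \<longlonglongrightarrow> V y" if "tends x y" for x y
    using continuous_map_limit[OF V that] by (simp add: o_def)
  \<comment> \<open>For fixed \<open>n\<close> the times \<open>- s' m\<close> eventually precede
    \<open>- s n\<close>, so monotonicity bounds \<open>V\<close> at \<open>- s n\<close> by its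
    limit \<open>V y'\<close>. Exchanging \<open>y\<close> and \<open>y'\<close> makes
    \<open>V\<close> constant on \<open>L\<close>.\<close>
  have V_le: "V y \<le> V y'" if L: "y \<in> L" "y' \<in> L" for y y'
  proof -
    obtain s s' where s: "tends (\<lambda>n. \<psi> (- s n)) y"
      and s': "filterlim s' at_top sequentially" "tends (\<lambda>n. \<psi> (- s' n)) y'"
      using L unfolding L_def by blast
    have "V (\<psi> (- s n)) \<le> V y'" for n
    proof (rule tendsto_lowerbound[OF V_lim[OF s'(2)]])
      show "\<forall>\<^sub>F m in sequentially. V (\<psi> (- s n)) \<le> V (\<psi> (- s' m))"
        using filterlim_at_top[THEN iffD1, OF s'(1), rule_format, of "s n"]
        by eventually_elim (rule V\<psi>, simp)
    qed simp
    then show ?thesis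
      by (intro tendsto_upperbound[OF V_lim[OF s]]) auto
  qed
  have step: "\<exists>v\<in>S. v 1 = y \<and> (\<forall>\<sigma>\<ge>0. v \<sigma> \<in> L)" if y: "y \<in> L" for y
  proof -
    obtain s where s: "filterlim s at_top sequentially" "tends (\<lambda>n. \<psi> (- s n)) y"
      using y by (auto simp: L_def)
    \<comment> \<open>Starting at time \<open>- 2 * s n\<close> leaves a diverging time
      \<open>s n\<close> to elapse before \<open>\<psi>\<close> reaches \<open>- s n\<close>, as
      \<open>backward_step\<close> requires.\<close>
    define us where "us n = (\<lambda>t\<in>{0..}. \<psi> (t + (- 2 * s n)))" for n
    have us: "us n \<in> S" for n unfolding us_def by (rule shift\<psi>)
    have bdd: "mbounded (range (\<lambda>n. us n 0))"
      by (rule mbounded_subset[OF compactin_imp_mbounded[OF K]]) (auto simp: us_def \<psi>K)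
    have lim: "tends (\<lambda>n. us n (s n)) y"
      using filterlim_at_top[THEN iffD1, OF s(1), rule_format, of 0]
      by (intro limitin_transform_eventually[OF _ s(2)]) (auto simp: us_def elim!: eventually_mono)
    obtain v where v: "v \<in> S" "v 1 = y"
      and sub: "\<And>\<sigma>. \<sigma> \<ge> 0 \<Longrightarrow> \<exists>r. strict_mono r \<and> tends (\<lambda>n. us (r n) (s (r n) + (\<sigma> - 1))) (v \<sigma>)"
      by (rule backward_step[of us, OF us bdd s(1) lim]) blast
    have "v \<sigma> \<in> L" if \<sigma>: "\<sigma> \<ge> 0" for \<sigma>
    proof -
      obtain r where r: "strict_mono r" "tends (\<lambda>n. us (r n) (s (r n) + (\<sigma> - 1))) (v \<sigma>)"
        using sub[OF \<sigma>] by blast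
      have sr: "filterlim (\<lambda>n. s (r n)) at_top sequentially"
        by (rule filterlim_subseq_compose[OF s(1) r(1)])
      have "filterlim (\<lambda>n. (1 - \<sigma>) + s (r n)) at_top sequentially"
        by (rule filterlim_tendsto_add_at_top[OF tendsto_const sr])
      moreover have "tends (\<lambda>n. \<psi> (- ((1 - \<sigma>) + s (r n)))) (v \<sigma>)"
        using filterlim_at_top[THEN iffD1, OF sr, rule_format, of "1 - \<sigma>"]
        by (intro limitin_transform_eventually[OF _ r(2)])
          (auto simp: us_def algebra_simps elim!: eventually_mono)
      ultimately show ?thesis unfolding L_def by blast
    qed
    with v show ?thesis by blast
  qed
  \<comment> \<open>Compactness of \<open>K\<close> makes \<open>L\<close> nonempty.\<close>
  obtain r y where r: "strict_mono (r :: nat \<Rightarrow> nat)" "tends (\<lambda>n. \<psi> (- real (r n))) y"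
    by (rule compactin_tends_subseq[OF K, of "\<lambda>n. \<psi> (- real n)"]) (rule \<psi>K)
  have lim: "filterlim (\<lambda>n. real (r n)) at_top sequentially"
    by (rule filterlim_subseq_compose[OF filterlim_real_sequentially r(1)])
  with r have yL: "y \<in> L" unfolding L_def by blast
  obtain \<phi> where \<phi>: "complete_trajectory S \<phi>" "\<phi> 0 = y" "\<And>t. \<phi> t \<in> L"
    by (rule complete_trajectory_through[OF step yL]) blast+
  have "V (\<phi> t) = V y" for t
    using V_le[OF \<phi>(3) yL] V_le[OF yL \<phi>(3)] by (rule antisym)
  then obtain z where "\<And>t. \<phi> t = z"
    using V_strict \<phi>(1) by blast
  with \<phi>(2) have "\<phi> t = y" for t by simp
  then have "(\<lambda>t\<in>{0..}. y) \<in> S"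
    using \<phi>(1) by (simp add: complete_trajectory_def)
  then have "y \<in> Z"
    using tends_in[OF r(2)] by (simp add: Z_def stationary_points_def)
  from that[OF this lim r(2)] show ?thesis .
qed

section \<open>Limit sets and the attractor\<close>

definition omega :: "'x set \<Rightarrow> 'x set" where
  "omega D = {z. \<exists>us t. (\<forall>n. us n \<in> S \<and> us n 0 \<in> D) \<and> filterlim t at_top sequentially \<and>
                   tends (\<lambda>n. us n (t n)) z}"

lemma omegaI:
  "\<lbrakk>\<And>n. us n \<in> S; \<And>n. us n 0 \<in> D; filterlim t at_top sequentially; tends (\<lambda>n. us n (t n)) z\<rbrakk>
    \<Longrightarrow> z \<in> omega D"
  unfolding omega_def by blast

lemma omega_subset: "omega D \<subseteq> M"
  by (auto simp: omega_def tends_in)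

text \<open>The values of the \<open>v\<close> from \<open>backward_step\<close> are limits along
  the times \<open>t + (s - 1)\<close>, which still diverge. This is the hypothesis of
  \<open>complete_trajectory_through\<close>.\<close>

lemma omega_step:
  assumes D: "mbounded D" and z: "z \<in> omega D"
  shows "\<exists>v\<in>S. v 1 = z \<and> (\<forall>s\<ge>0. v s \<in> omega D)"
proof -
  obtain us t where us: "\<And>n. us n \<in> S" "\<And>n. us n 0 \<in> D"
    and t: "filterlim t at_top sequentially" and lim: "tends (\<lambda>n. us n (t n)) z"
    using z by (auto simp: omega_def)
  have "mbounded (range (\<lambda>n. us n 0))"
    by (rule mbounded_subset[OF D]) (auto simp: us)
  then obtain v where v: "v \<in> S" "v 1 = z"
    and sub: "\<And>s. s \<ge> 0 \<Longrightarrow> \<exists>r. strict_mono r \<and> tends (\<lambda>n. us (r n) (t (r n) + (s - 1))) (v s)"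
    by (rule backward_step[of us, OF us(1) _ t lim]) blast
  have "v s \<in> omega D" if s: "s \<ge> 0" for s
  proof -
    obtain r where r: "strict_mono r" "tends (\<lambda>n. us (r n) (t (r n) + (s - 1))) (v s)"
      using sub[OF s] by blast
    have "filterlim (\<lambda>n. t (r n) + (s - 1)) at_top sequentially"
      using filterlim_tendsto_add_at_top[OF tendsto_const[of "s - 1"]
          filterlim_subseq_compose[OF t r(1)]] by (simp add: add.commute)
    from omegaI[of "\<lambda>n. us (r n)", OF us this r(2)] show ?thesis .
  qed
  with v show ?thesis by blast
qed

lemma omega_complete_trajectory:
  assumes "mbounded D" "z \<in> omega D"
  obtains \<psi> where "complete_trajectory S \<psi>" "\<psi> 0 = z" "\<And>t. \<psi> t \<in> omega D"
  by (rule complete_trajectory_through[OF omega_step[OF assms(1)] assms(2)]) (use that in blast)+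

text \<open>A diagonal argument: \<open>\<sigma> n\<close> is within \<open>1/(n+1)\<close> of a
  trajectory from \<open>D\<close> at some time \<open>\<ge> n\<close>. These approximants have a
  convergent subsequence, and \<open>\<sigma>\<close> shares its limit.\<close>

lemma compactin_omega:
  assumes D: "mbounded D"
  shows "compactin mtopology (omega D)"
  unfolding compactin_sequentially
proof (intro conjI allI impI omega_subset)
  fix \<sigma> :: "nat \<Rightarrow> 'x"
  assume "range \<sigma> \<subseteq> omega D"
  then have \<sigma>: "\<sigma> n \<in> omega D" for n by auto
  have "\<exists>u t. u \<in> S \<and> u 0 \<in> D \<and> t \<ge> real n \<and> u t \<in> M \<and> d (u t) (\<sigma> n) < inverse (Suc n)" for n
  proof -
    obtain us t where us: "\<And>n. us n \<in> S" "\<And>n. us n 0 \<in> D"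
      and t: "filterlim t at_top sequentially" and lim: "tends (\<lambda>n. us n (t n)) (\<sigma> n)"
      using \<sigma>[of n] by (auto simp: omega_def)
    have "\<forall>\<^sub>F k in sequentially. t k \<ge> real n"
      using t by (simp add: filterlim_at_top)
    moreover have "\<forall>\<^sub>F k in sequentially. us k (t k) \<in> M \<and> d (us k (t k)) (\<sigma> n) < inverse (Suc n)"
      using lim by (simp add: limitin_metric)
    ultimately have "\<forall>\<^sub>F k in sequentially. t k \<ge> real n \<and> us k (t k) \<in> M \<and>
        d (us k (t k)) (\<sigma> n) < inverse (Suc n)"
      by (rule eventually_elim2) blast
    then obtain k where "t k \<ge> real n" "us k (t k) \<in> M" "d (us k (t k)) (\<sigma> n) < inverse (Suc n)"
      using eventually_happens'[OF sequentially_bot] by blast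
    with us show ?thesis by blast
  qed
  then have "\<exists>us t. \<forall>n. us n \<in> S \<and> us n 0 \<in> D \<and> t n \<ge> real n \<and> us n (t n) \<in> M \<and>
      d (us n (t n)) (\<sigma> n) < inverse (Suc n)"
    by (rule choice2)
  then obtain us t where us: "\<And>n. us n \<in> S" "\<And>n. us n 0 \<in> D" and t: "\<And>n. t n \<ge> real n"
    and close: "\<And>n. us n (t n) \<in> M" "\<And>n. d (us n (t n)) (\<sigma> n) < inverse (Suc n)"
    by blast
  have t_lim: "filterlim t at_top sequentially"
    by (rule filterlim_at_top_mono[OF filterlim_real_sequentially]) (simp add: t)
  have "mbounded (range (\<lambda>n. us n 0))"
    by (rule mbounded_subset[OF D]) (auto simp: us)
  then obtain r z
    where r: "strict_mono (r :: nat \<Rightarrow> nat)" and lim: "tends (\<lambda>n. us (r n) (t (r n))) z"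
    by (rule asymptotically_compact[of us, OF us(1) _ t_lim])
  have z: "z \<in> omega D"
    by (rule omegaI[of "\<lambda>n. us (r n)", OF us filterlim_subseq_compose[OF t_lim r] lim])
  have "tends (\<lambda>n. \<sigma> (r n)) z"
    unfolding limitin_metric_dist_null
  proof (intro conjI)
    show "z \<in> M" by (rule tends_in[OF lim])
    have \<sigma>M: "\<sigma> n \<in> M" for n using \<sigma> omega_subset by blast
    then show "\<forall>\<^sub>F n in sequentially. \<sigma> (r n) \<in> M" by simp
    show "(\<lambda>n. d (\<sigma> (r n)) z) \<longlonglongrightarrow> 0"
    proof (rule tendsto_sandwich[OF _ _ tendsto_const])
      have "(\<lambda>n. inverse (real (Suc (r n)))) \<longlonglongrightarrow> 0"
        by (rule filterlim_subseq_compose[OF LIMSEQ_inverse_real_of_nat r])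
      then show "(\<lambda>n. inverse (real (Suc (r n))) + d (us (r n) (t (r n))) z) \<longlonglongrightarrow> 0"
        using lim unfolding limitin_metric_dist_null by (auto intro: tendsto_add_zero)
      have "d (\<sigma> (r n)) z \<le> inverse (real (Suc (r n))) + d (us (r n) (t (r n))) z" for n
        using triangle[OF \<sigma>M close(1) \<open>z \<in> M\<close>, of "r n" "r n"] close(2)[of "r n"]
        by (simp add: commute[of "\<sigma> (r n)"])
      then show "\<forall>\<^sub>F n in sequentially.
          d (\<sigma> (r n)) z \<le> inverse (real (Suc (r n))) + d (us (r n) (t (r n))) z" by simp
    qed simp
  qed
  with z r show "\<exists>l r. l \<in> omega D \<and> strict_mono r \<and> tends (\<sigma> \<circ> r) l"
    by (auto simp: o_def)
qed

section \<open>The attractor as limit set of a neighbourhood of the stationary points\<close>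

definition stationary_nbhd :: "'x set" where
  "stationary_nbhd = (\<Union>z\<in>Z. mball z 1)"

definition \<A> :: "'x set" where
  "\<A> = omega stationary_nbhd"

lemma mbounded_Union_mball:
  assumes "mbounded B"
  shows "mbounded (\<Union>z\<in>B. mball z r)"
proof -
  obtain x C where B: "B \<subseteq> mcball x C" using assms by (auto simp: mbounded_def)
  have "mball z r \<subseteq> mcball x (C + r)" if "z \<in> B" for z
  proof
    fix y assume "y \<in> mball z r"
    then show "y \<in> mcball x (C + r)"
      using B that triangle[of x z y] by fastforce
  qed
  then show ?thesis unfolding mbounded_def by blast
qed

lemma mbounded_stationary_nbhd: "mbounded stationary_nbhd"
  using mbounded_Union_mball[of Z 1] L2 by (simp add: stationary_nbhd_def Z_def cond_L2_def)

text \<open>Backward in time \<open>\<psi>\<close> approaches a stationary point along a sequence;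
  restarting it at those times gives the trajectories. They hit \<open>\<psi> 0\<close> exactly, not
  just in the limit.\<close>

lemma reached_from_stationary_nbhd:
  assumes \<psi>: "complete_trajectory S \<psi>" and K: "compactin mtopology K" "\<And>t. \<psi> t \<in> K"
  obtains us s where "\<And>n::nat. us n \<in> S" "\<And>n. us n 0 \<in> stationary_nbhd" "filterlim s at_top sequentially"
    "\<And>n. s n > 0" "\<And>n. us n (s n) = \<psi> 0"
proof -
  obtain y s where y: "y \<in> Z" and s: "filterlim s at_top sequentially"
    and lim: "tends (\<lambda>n. \<psi> (- s n)) y"
    using alpha_limit_stationary[OF assms] by blast
  have "\<forall>\<^sub>F n in sequentially. \<psi> (- s n) \<in> stationary_nbhd"
  proof -
    have "\<forall>\<^sub>F n in sequentially. \<psi> (- s n) \<in> M \<and> d (\<psi> (- s n)) y < 1"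
      using lim by (simp add: limitin_metric)
    then show ?thesis
      by eventually_elim (use y tends_in[OF lim] in \<open>auto simp: stationary_nbhd_def commute\<close>)
  qed
  moreover have "\<forall>\<^sub>F n in sequentially. s n > 0"
    using s by (simp add: filterlim_at_top_dense)
  ultimately have "\<forall>\<^sub>F n in sequentially. \<psi> (- s n) \<in> stationary_nbhd \<and> s n > 0"
    by (rule eventually_conj)
  then obtain N where N: "\<And>n. n \<ge> N \<Longrightarrow> \<psi> (- s n) \<in> stationary_nbhd \<and> s n > 0"
    by (auto simp: eventually_sequentially)
  \<comment> \<open>Dropping the first \<open>N\<close> terms makes both eventual properties hold
    for every index.\<close>
  define s' where "s' n = s (n + N)" for n
  show ?thesis
  proof (rule that[of "\<lambda>n. \<lambda>t\<in>{0..}. \<psi> (t + (- s' n))" s'])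
    show "(\<lambda>t\<in>{0..}. \<psi> (t + (- s' n))) \<in> S" for n
      using \<psi> unfolding complete_trajectory_def by blast
    show "filterlim s' at_top sequentially"
      unfolding s'_def by (rule filterlim_subseq_compose[OF s]) (simp add: strict_mono_def)
    show pos: "s' n > 0" for n using N by (simp add: s'_def)
    show "(\<lambda>t\<in>{0..}. \<psi> (t + (- s' n))) 0 \<in> stationary_nbhd" for n using N by (simp add: s'_def)
    show "(\<lambda>t\<in>{0..}. \<psi> (t + (- s' n))) (s' n) = \<psi> 0" for n using pos[of n] by simp
  qed
qed

lemma reached_from_stationary_nbhd_omega:
  assumes "mbounded D" "z \<in> omega D"
  obtains us s where "\<And>n::nat. us n \<in> S" "\<And>n. us n 0 \<in> stationary_nbhd" "filterlim s at_top sequentially"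
    "\<And>n. s n > 0" "\<And>n. us n (s n) = z"
proof -
  obtain \<psi> where \<psi>: "complete_trajectory S \<psi>" "\<psi> 0 = z" "\<And>t. \<psi> t \<in> omega D"
    using omega_complete_trajectory[OF assms] by blast
  show ?thesis
    using reached_from_stationary_nbhd[OF \<psi>(1) compactin_omega[OF assms(1)] \<psi>(3)] that \<psi>(2) by metis
qed

text \<open>As \<open>z\<close> is hit exactly at diverging times, a constant sequence exhibits it
  as a limit point of \<open>stationary_nbhd\<close>.\<close>

lemma omega_subset_attractor:
  assumes "mbounded D"
  shows "omega D \<subseteq> \<A>"
proof
  fix z assume z: "z \<in> omega D"
  obtain us s where us: "\<And>n::nat. us n \<in> S" "\<And>n. us n 0 \<in> stationary_nbhd" and s: "filterlim s at_top sequentially"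
    and eq: "\<And>n. us n (s n) = z"
    using reached_from_stationary_nbhd_omega[OF assms z] by metis
  have "tends (\<lambda>n. us n (s n)) z"
    using z omega_subset by (auto simp: eq)
  with us s show "z \<in> \<A>" unfolding \<A>_def by (intro omegaI)
qed

text \<open>Exact arrival at \<open>z\<close> lets (S3) append the given \<open>v\<close>, although
  several trajectories may start at \<open>z\<close>.\<close>

lemma attractor_forward_invariant:
  assumes "z \<in> \<A>" and v: "v \<in> S" "v 0 = z" and t: "t \<ge> 0"
  shows "v t \<in> \<A>"
proof -
  obtain us s where us: "\<And>n::nat. us n \<in> S" "\<And>n. us n 0 \<in> stationary_nbhd"
    and s: "filterlim s at_top sequentially" "\<And>n. s n > 0" and eq: "\<And>n. us n (s n) = z"
    using reached_from_stationary_nbhd_omega[OF mbounded_stationary_nbhd] \<open>z \<in> \<A>\<close> unfolding \<A>_def by metis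
  define p where "p n = (\<lambda>\<tau>\<in>{0..}. if \<tau> \<le> s n then us n \<tau> else v (\<tau> - s n))" for n
  have "p n \<in> S" for n
    unfolding p_def using us s eq v by (intro concat_in) auto
  moreover have "p n 0 \<in> stationary_nbhd" for n
    using us s(2)[of n] by (simp add: p_def)
  moreover have "filterlim (\<lambda>n. t + s n) at_top sequentially"
    by (rule filterlim_tendsto_add_at_top[OF tendsto_const s(1)])
  \<comment> \<open>For \<open>t = 0\<close> the first branch of \<open>p n\<close> applies, and
    both branches have the value \<open>z\<close> there.\<close>
  moreover have "p n (t + s n) = v t" for n
    using t s(2)[of n] eq[of n] v(2) by (cases "t = 0") (auto simp: p_def)
  then have "tends (\<lambda>n. p n (t + s n)) (v t)"
    using traj_in[OF v(1) t] by simp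
  ultimately show ?thesis unfolding \<A>_def by (rule omegaI)
qed

text \<open>For the inclusion of \<open>\<A>\<close> in its image, a complete trajectory inside
  \<open>\<A>\<close> is started at time \<open>- t\<close>.\<close>

lemma reach_attractor:
  assumes "t \<ge> 0"
  shows "reach S t \<A> = \<A>"
proof
  show "reach S t \<A> \<subseteq> \<A>"
    using attractor_forward_invariant assms by (auto simp: reach_def)
  show "\<A> \<subseteq> reach S t \<A>"
  proof
    fix z assume "z \<in> \<A>"
    then obtain \<psi> where \<psi>: "complete_trajectory S \<psi>" "\<psi> 0 = z" "\<And>t. \<psi> t \<in> \<A>"
      using omega_complete_trajectory[OF mbounded_stationary_nbhd] unfolding \<A>_def by metis
    define u where "u = (\<lambda>\<tau>\<in>{0..}. \<psi> (\<tau> + (- t)))"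
    have "u \<in> S" using \<psi>(1) unfolding u_def complete_trajectory_def by blast
    moreover have "u 0 \<in> \<A>" "u t = z" using \<psi> assms by (auto simp: u_def)
    ultimately show "z \<in> reach S t \<A>" by (auto simp: reach_def)
  qed
qed

text \<open>Otherwise trajectories from \<open>D\<close> stay \<open>\<epsilon>\<close> away from
  \<open>\<A>\<close> at arbitrarily late times; a limit point of them lies in
  \<open>omega D\<close>, hence in \<open>\<A>\<close>.\<close>

lemma attractor_attracts:
  assumes D: "mbounded D" and \<epsilon>: "\<epsilon> > 0"
  shows "\<forall>\<^sub>F t in at_top. \<forall>e\<in>reach S t D. \<exists>a\<in>\<A>. d e a < \<epsilon>"
proof (rule ccontr)
  assume "\<not> ?thesis"
  then have "\<exists>t e. t \<ge> real n \<and> e \<in> reach S t D \<and> (\<forall>a\<in>\<A>. \<not> d e a < \<epsilon>)" for n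
    unfolding eventually_at_top_linorder by blast
  then have "\<exists>u t. u \<in> S \<and> u 0 \<in> D \<and> t \<ge> real n \<and> (\<forall>a\<in>\<A>. \<not> d (u t) a < \<epsilon>)" for n
    unfolding reach_def by blast
  then have "\<exists>us t. \<forall>n. us n \<in> S \<and> us n 0 \<in> D \<and> t n \<ge> real n \<and>
      (\<forall>a\<in>\<A>. \<not> d (us n (t n)) a < \<epsilon>)"
    by (rule choice2)
  then obtain us t where us: "\<And>n. us n \<in> S" "\<And>n. us n 0 \<in> D" and t: "\<And>n. t n \<ge> real n"
    and far: "\<And>n a. a \<in> \<A> \<Longrightarrow> \<not> d (us n (t n)) a < \<epsilon>"
    by blast
  have t_lim: "filterlim t at_top sequentially"
    by (rule filterlim_at_top_mono[OF filterlim_real_sequentially]) (simp add: t)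
  have "mbounded (range (\<lambda>n. us n 0))"
    by (rule mbounded_subset[OF D]) (auto simp: us)
  then obtain r z
    where r: "strict_mono (r :: nat \<Rightarrow> nat)" and lim: "tends (\<lambda>n. us (r n) (t (r n))) z"
    by (rule asymptotically_compact[of us, OF us(1) _ t_lim])
  have "z \<in> omega D"
    by (rule omegaI[of "\<lambda>n. us (r n)", OF us filterlim_subseq_compose[OF t_lim r] lim])
  then have "z \<in> \<A>" using omega_subset_attractor[OF D] by blast
  moreover have "\<forall>\<^sub>F n in sequentially. d (us (r n) (t (r n))) z < \<epsilon>"
    using lim \<epsilon> by (auto simp: limitin_metric elim: eventually_mono)
  ultimately show False
    using far by (simp add: eventually_False trivial_limit_sequentially)
qed

lemma global_attractor_attractor: "global_attractor M d S \<A>"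
  unfolding global_attractor_def
proof (intro conjI allI impI)
  show "compactin mtopology \<A>"
    unfolding \<A>_def by (rule compactin_omega[OF mbounded_stationary_nbhd])
  show "reach S t \<A> = \<A>" if "t \<ge> 0" for t by (rule reach_attractor[OF that])
  fix D assume D: "mbounded D"
  show "((\<lambda>t. SUP e\<in>reach S t D. INF a\<in>\<A>. ennreal (d e a)) \<longlongrightarrow> 0) at_top"
  proof (rule order_tendstoI)
    fix c :: ennreal assume "0 < c"
    \<comment> \<open>A finite \<open>\<epsilon>\<close> is chosen because \<open>c\<close> may be
      infinite.\<close>
    then obtain \<epsilon> where \<epsilon>: "\<epsilon> > 0" "ennreal \<epsilon> < c"
      by (metis dense ennreal_cases ennreal_less_zero_iff infinity_ennreal_def not_less top_greatest)
    show "\<forall>\<^sub>F t in at_top. (SUP e\<in>reach S t D. INF a\<in>\<A>. ennreal (d e a)) < c"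
      using attractor_attracts[OF D \<epsilon>(1)]
    proof eventually_elim
      case (elim t)
      have "(SUP e\<in>reach S t D. INF a\<in>\<A>. ennreal (d e a)) \<le> ennreal \<epsilon>"
      proof (rule SUP_least)
        fix e assume "e \<in> reach S t D"
        with elim obtain a where "a \<in> \<A>" "d e a < \<epsilon>" by blast
        then show "(INF a\<in>\<A>. ennreal (d e a)) \<le> ennreal \<epsilon>"
          by (intro INF_lower2[of a]) (auto intro: ennreal_leI)
      qed
      from this \<epsilon>(2) show ?case by (rule le_less_trans)
    qed
  qed simp
qed

section \<open>Uniqueness of the attractor and pointwise dissipativity\<close>

lemma global_attractor_subset:
  assumes A: "global_attractor M d S A" and A': "global_attractor M d S A'"
  shows "A \<subseteq> A'"
proof
  fix z assume z: "z \<in> A"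
  have cA: "compactin mtopology A" and inv: "\<And>t. t \<ge> 0 \<Longrightarrow> reach S t A = A"
    using A by (auto simp: global_attractor_def)
  have cA': "compactin mtopology A'"
    and attr: "\<And>D. mbounded D \<Longrightarrow>
      ((\<lambda>t. SUP e\<in>reach S t D. INF a\<in>A'. ennreal (d e a)) \<longlongrightarrow> 0) at_top"
    using A' by (auto simp: global_attractor_def)
  have zM: "z \<in> M" using compactin_subset_topspace[OF cA] z by auto
  \<comment> \<open>\<open>A\<close> is compact, hence bounded, so \<open>A'\<close> attracts it.
    Invariance of \<open>A\<close> then removes \<open>t\<close> from the semidistance, which must
    vanish; \<open>A'\<close> is closed.\<close>
  have lim: "((\<lambda>t::real. SUP e\<in>reach S t A. INF a\<in>A'. ennreal (d e a)) \<longlongrightarrow> 0) at_top"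
    by (rule attr[OF compactin_imp_mbounded[OF cA]])
  have near: "\<exists>a\<in>A'. d z a < r" if "r > 0" for r
  proof -
    have "\<forall>\<^sub>F t::real in at_top. (SUP e\<in>reach S t A. INF a\<in>A'. ennreal (d e a)) < ennreal r"
      using that by (intro order_tendstoD(2)[OF lim]) simp
    with eventually_ge_at_top[of "0::real"]
    have "\<forall>\<^sub>F t::real in at_top. (SUP e\<in>A. INF a\<in>A'. ennreal (d e a)) < ennreal r"
      by eventually_elim (simp add: inv)
    then have "(SUP e\<in>A. INF a\<in>A'. ennreal (d e a)) < ennreal r" by simp
    then have "(INF a\<in>A'. ennreal (d z a)) < ennreal r"
      using z by (meson SUP_upper le_less_trans)
    then show ?thesis by (auto simp: INF_less_iff ennreal_less_iff)
  qed
  have A'M: "A' \<subseteq> M" using compactin_subset_topspace[OF cA'] by simp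
  have "z \<in> mtopology closure_of A'"
    unfolding metric_closure_of using zM near A'M by fastforce
  moreover have "closedin mtopology A'"
    by (rule compactin_imp_closedin[OF Hausdorff_space_mtopology cA'])
  ultimately show "z \<in> A'" by (simp add: closure_of_closedin)
qed

text \<open>Attraction of the bounded set \<open>{u 0}\<close> brings \<open>u\<close> into the unit
  neighbourhood of \<open>\<A>\<close>, which is bounded and independent of
  \<open>u\<close>.\<close>

lemma pointwise_dissipative: "pointwise_dissipative M d S"
  unfolding pointwise_dissipative_def
proof (intro exI conjI ballI)
  show "mbounded (\<Union>z\<in>\<A>. mball z 1)"
    unfolding \<A>_def
    by (rule mbounded_Union_mball[OF compactin_imp_mbounded[OF compactin_omega[OF mbounded_stationary_nbhd]]])
  fix u assume u: "u \<in> S"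
  have "mbounded {u 0}" using traj_in[OF u, of 0] by (simp add: mbounded_insert)
  from attractor_attracts[OF this zero_less_one] eventually_ge_at_top[of "0::real"]
  show "\<forall>\<^sub>F t in at_top. u t \<in> (\<Union>z\<in>\<A>. mball z 1)"
  proof (eventually_elim)
    case (elim t)
    have "u t \<in> reach S t {u 0}" using u by (auto simp: reach_def)
    with elim obtain a where a: "a \<in> \<A>" "d (u t) a < 1" by auto
    moreover have "a \<in> M" using a(1) omega_subset unfolding \<A>_def by blast
    ultimately show ?case using traj_in[OF u] elim by (auto simp: commute)
  qed
qed

theorem dissipative_and_unique_attractor:
  "pointwise_dissipative M d S \<and> (\<exists>!A. global_attractor M d S A)"
  using pointwise_dissipative global_attractor_attractor global_attractor_subset
  by (metis subset_antisym)

end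

section \<open>Weak and strong limits in the phase space\<close>

lemma l2_Cauchy_Schwarz:
  fixes f g :: "'a::euclidean_space \<Rightarrow> real"
  assumes f: "f \<in> l2_functions \<Omega>" and g: "g \<in> l2_functions \<Omega>"
  shows "\<bar>l2_inner \<Omega> f g\<bar> \<le> l2_norm \<Omega> f * l2_norm \<Omega> g"
proof -
  let ?M = "lebesgue_on \<Omega>"
  define A B C where "A = (LINT x|?M. (f x)\<^sup>2)" and "B = (LINT x|?M. (g x)\<^sup>2)"
    and "C = (LINT x|?M. f x * g x)"
  have int: "integrable ?M (\<lambda>x. (f x)\<^sup>2)" "integrable ?M (\<lambda>x. (g x)\<^sup>2)"
      "integrable ?M (\<lambda>x. f x * g x)"
    using assms l2_functions_mult[OF f g] by (auto simp: l2_functions_def)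
  have A0: "A \<ge> 0" and B0: "B \<ge> 0" unfolding A_def B_def by auto
  have "0 \<le> (LINT x|?M. (f x + s * g x)\<^sup>2)" for s by simp
  also have "(LINT x|?M. (f x + s * g x)\<^sup>2) = A + 2 * s * C + s\<^sup>2 * B" for s
  proof -
    have "(LINT x|?M. (f x + s * g x)\<^sup>2)
        = (LINT x|?M. (f x)\<^sup>2 + (2 * s) * (f x * g x) + s\<^sup>2 * (g x)\<^sup>2)"
      by (rule Bochner_Integration.integral_cong) (auto simp: power2_eq_square algebra_simps)
    also have "\<dots> = A + 2 * s * C + s\<^sup>2 * B"
      using int by (simp add: A_def B_def C_def)
    finally show ?thesis .
  qed
  finally have nn: "0 \<le> A + 2 * s * C + s\<^sup>2 * B" for s .
  have "C\<^sup>2 \<le> A * B"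
  proof (cases "B = 0")
    case True
    have "C = 0"
    proof (rule ccontr)
      assume "C \<noteq> 0"
      \<comment> \<open>With \<open>B = 0\<close> the nonnegative polynomial is affine in
        \<open>s\<close>; at this \<open>s\<close> it would be \<open>-1\<close>.\<close>
      then have "2 * (- (A + 1) / (2 * C)) * C = - (A + 1)" by simp
      then show False using nn[of "- (A + 1) / (2 * C)"] True by simp
    qed
    then show ?thesis using True by simp
  next
    case False
    then have "B > 0" using B0 by simp
    \<comment> \<open>\<open>- C / B\<close> minimizes the quadratic polynomial in
      \<open>s\<close>.\<close>
    then show ?thesis using nn[of "- C / B"] by (simp add: field_simps power2_eq_square)
  qed
  then have "\<bar>C\<bar> \<le> sqrt A * sqrt B"
    by (metis real_sqrt_abs real_sqrt_le_iff real_sqrt_mult)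
  then show ?thesis
    by (simp add: l2_inner_def l2_norm_def A_def B_def C_def)
qed

lemma l2_inner_diff_left:
  fixes f g h :: "'a::euclidean_space \<Rightarrow> real"
  assumes "f \<in> l2_functions \<Omega>" "g \<in> l2_functions \<Omega>" "h \<in> l2_functions \<Omega>"
  shows "l2_inner \<Omega> (\<lambda>x. f x - g x) h = l2_inner \<Omega> f h - l2_inner \<Omega> g h"
  using l2_functions_mult[OF assms(1,3)] l2_functions_mult[OF assms(2,3)]
  by (simp add: l2_inner_def left_diff_distrib)

lemma l2_norm_le_d2: "l2_norm \<Omega> (\<lambda>x. rep u x - rep v x) \<le> d2 \<Omega> W lam u v"
  unfolding d2_def by (rule real_le_rsqrt) simp

text \<open>An element of the phase space is determined by its class in \<open>L2 \<Omega>\<close>,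
  so comparing the first components of the two limits is enough.\<close>

lemma weak_limit_eq_strong_limit:
  assumes weak: "weakly_tends \<Omega> W lam x y sequentially" and y: "y \<in> X2 \<Omega> I W"
    and r: "strict_mono (r :: nat \<Rightarrow> nat)"
    and strong: "limitin (Metric_space.mtopology (X2 \<Omega> I W) (d2 \<Omega> W lam)) (\<lambda>n. x (r n)) z sequentially"
  shows "y = z"
proof -
  interpret Metric_space "X2 \<Omega> I W" "d2 \<Omega> W lam" by (rule X2_Metric_space)
  have z: "z \<in> X2 \<Omega> I W" and ev: "\<forall>\<^sub>F n in sequentially. x (r n) \<in> X2 \<Omega> I W"
    and lim: "(\<lambda>n. d2 \<Omega> W lam (x (r n)) z) \<longlonglongrightarrow> 0"
    using strong by (auto simp: limitin_metric_dist_null)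
  note yz = X2_components(1,2)[OF y] X2_components(1,2)[OF z]
  \<comment> \<open>Testing with the difference of the two limits turns equality of the inner
    products into vanishing of its norm.\<close>
  define h where "h = (\<lambda>t. rep y t - rep z t)"
  have h: "h \<in> l2_functions \<Omega>" unfolding h_def by (rule l2_functions_diff[OF yz(2,4)])
  have "(\<lambda>n. l2_inner \<Omega> (rep (x (r n))) h) \<longlonglongrightarrow> l2_inner \<Omega> (rep y) h"
    using weak h filterlim_subseq_compose[OF _ r] unfolding weakly_tends_def by blast
  moreover have "(\<lambda>n. l2_inner \<Omega> (rep (x (r n))) h) \<longlonglongrightarrow> l2_inner \<Omega> (rep z) h"
  proof (rule LIM_zero_cancel, rule Lim_null_comparison)
    show "(\<lambda>n. d2 \<Omega> W lam (x (r n)) z * l2_norm \<Omega> h) \<longlonglongrightarrow> 0"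
      by (rule tendsto_mult_left_zero[OF lim])
    show "\<forall>\<^sub>F n in sequentially. norm (l2_inner \<Omega> (rep (x (r n))) h - l2_inner \<Omega> (rep z) h)
        \<le> d2 \<Omega> W lam (x (r n)) z * l2_norm \<Omega> h"
      using ev
    proof eventually_elim
      case (elim n)
      note xn = X2_components(2)[OF elim]
      have "\<bar>l2_inner \<Omega> (rep (x (r n))) h - l2_inner \<Omega> (rep z) h\<bar>
          \<le> l2_norm \<Omega> (\<lambda>t. rep (x (r n)) t - rep z t) * l2_norm \<Omega> h"
        using l2_Cauchy_Schwarz[OF l2_functions_diff[OF xn yz(4)] h]
        by (simp add: l2_inner_diff_left[OF xn yz(4) h])
      also have "\<dots> \<le> d2 \<Omega> W lam (x (r n)) z * l2_norm \<Omega> h"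
        by (intro mult_right_mono l2_norm_le_d2) (simp add: l2_norm_def)
      finally show ?case by simp
    qed
  qed
  ultimately have "l2_inner \<Omega> (rep y) h = l2_inner \<Omega> (rep z) h"
    by (rule LIMSEQ_unique)
  then have "l2_inner \<Omega> h h = 0"
    using l2_inner_diff_left[OF yz(2,4) h] by (simp add: h_def)
  then have "(LINT t|lebesgue_on \<Omega>. (h t)\<^sup>2) = 0"
    by (simp add: l2_inner_def power2_eq_square)
  moreover have "integrable (lebesgue_on \<Omega>) (\<lambda>t. (h t)\<^sup>2)"
    using h by (simp add: l2_functions_def)
  ultimately have "AE t in lebesgue_on \<Omega>. (h t)\<^sup>2 = 0"
    by (subst (asm) integral_nonneg_eq_0_iff_AE) auto
  then show "y = z"
    by (intro L2_eqI[OF yz(1,3)]) (auto simp: h_def)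
qed

section \<open>Application to the phase space \<open>X2\<close>\<close>

theorem proposition7p4:
  fixes \<Omega> :: "(real ^ 'n) set"
    and a b :: ereal and W :: "real \<Rightarrow> real" and lam :: real
    and X :: "(real ^ 'n \<Rightarrow> real) set set"
    and d :: "(real ^ 'n \<Rightarrow> real) set \<Rightarrow> (real ^ 'n \<Rightarrow> real) set \<Rightarrow> real"
    and S :: "(real \<Rightarrow> (real ^ 'n \<Rightarrow> real) set) set"
  assumes "CARD('n) \<le> 3"
    and "bounded_smooth_domain \<Omega>"
    and "lam \<ge> 0"
    and "0 \<in> einterval a b"
    and "admissible_potential a b W lam"
    and X_eq: "X = X2 \<Omega> (einterval a b) W"
    and d_eq: "d = d2 \<Omega> W lam"
    and "S \<subseteq> {0..} \<rightarrow>\<^sub>E X"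
    and "cond_S1 X S" and "cond_S2 S" and "cond_S3 S" and "cond_S4 S"
    and "cond_S5 \<Omega> (einterval a b) W lam S"
    and "cond_L1 X d S" and "cond_L2 X d S" and "cond_L3 X d S"
  shows "pointwise_dissipative X d S \<and> (\<exists>!A. global_attractor X d S A)"
proof -
  interpret X2: Metric_space X d
    unfolding X_eq d_eq by (rule X2_Metric_space)
  \<comment> \<open>The closedness part of (S5) gives \<open>weak_closed\<close>, and
    \<open>weak_limit_eq_strong_limit\<close> gives \<open>weak_eq_strong\<close>.\<close>
  interpret gradient_family X d S "\<lambda>x y. weakly_tends \<Omega> W lam x y sequentially"
  proof unfold_locales
    fix us :: "nat \<Rightarrow> real \<Rightarrow> (real ^ 'n \<Rightarrow> real) set" and u0
    assume "\<And>n. us n \<in> S" "limitin X2.mtopology (\<lambda>n. us n 0) u0 sequentially"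
    then show "\<exists>r u. strict_mono r \<and> u \<in> S \<and> u 0 = u0 \<and>
        (\<forall>t>0. weakly_tends \<Omega> W lam (\<lambda>n. us (r n) t) (u t) sequentially)"
      using \<open>cond_S5 \<Omega> (einterval a b) W lam S\<close> unfolding cond_S5_def X_eq d_eq by blast
  next
    fix x y z and r :: "nat \<Rightarrow> nat"
    assume "weakly_tends \<Omega> W lam x y sequentially" "y \<in> X" "strict_mono r"
      "limitin X2.mtopology (\<lambda>n. x (r n)) z sequentially"
    then show "y = z"
      unfolding X_eq d_eq by (rule weak_limit_eq_strong_limit)
  qed (fact assms)+
  show ?thesis by (rule dissipative_and_unique_attractor)
qed

end
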